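(* For any integer $m\geq 2$ and any integer $c$ with $4m\le c\le 16m^2$ and $c\neq 4m+1$, there exists a quantum Latin square of order $4m$ over the $4m$-dimensional Hilbert space $\mathcal{H}_m\otimes\mathcal{H}_2\otimes\mathcal{H}_2$ with cardinality exactly $c$.
   Context: $\mathcal{H}_n$ denotes the $n$-dimensional complex Hilbert space $\mathbb{C}^n$. A quantum Latin square of order $n$, denoted QLS$(n)$, over an $n$-dimensional complex Hilbert space $\mathcal{H}$ is an $n\times n$ array whose entries are unit vectors of $\mathcal{H}$ such that the entries of each row form an orthonormal basis of $\mathcal{H}$ and the entries of each column form an orthonormal basis of $\mathcal{H}$. Two unit vectors $|u\rangle,|v\rangle\in\mathcal{H}$ are regarded as identical if there is a real number $\theta$ with $|u\rangle=e^{i\theta}|v\rangle$; otherwise they are distinct. The cardinality of a QLS$(n)$ is the number of distinct vectors (in this sense) appearing among its $n^2$ entries. *)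

theory Defs
  imports "Jordan_Normal_Form.VS_Connect"
begin

text \<open>
  The Hilbert space \<open>\<H>\<^sub>n\<close> is \<open>carrier_vec n :: complex vec set\<close> with the Hermitian form
  \<open>u \<bullet>c v\<close>, which is conjugate-linear in \<open>v\<close>. \<open>cspan d S\<close> is the linear span taken inside
  \<open>\<complex>\<^sup>d\<close>, so it is only meaningful for \<open>S \<subseteq> carrier_vec d\<close>.
\<close>

abbreviation cspan :: "nat \<Rightarrow> complex vec set \<Rightarrow> complex vec set" where
  "cspan d \<equiv> LinearCombinations.module.span class_ring (module_vec TYPE(complex) d)"

text \<open>
  Tensor products are realised by Kronecker products: the coordinate of \<open>u \<otimes> v\<close> with index pair
  \<open>(a, b)\<close> sits at position \<open>a * dim_vec v + b\<close>. The standard Hermitian form of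
  \<open>\<complex>\<^sup>p\<^sup>q\<close> then satisfies \<open>\<langle>u \<otimes> v, u' \<otimes> v'\<rangle> = \<langle>u, u'\<rangle> \<langle>v, v'\<rangle>\<close>, see
  \<open>tensor_vec_cscalar_prod\<close> below.
\<close>

definition tensor_vec :: "complex vec \<Rightarrow> complex vec \<Rightarrow> complex vec" where
  "tensor_vec u v = vec (dim_vec u * dim_vec v) (\<lambda>k. u $ (k div dim_vec v) * v $ (k mod dim_vec v))"

text \<open>\<open>U\<close> and \<open>V\<close> are subspaces of \<open>\<complex>\<^sup>p\<close> and \<open>\<complex>\<^sup>q\<close>.\<close>

definition tensor_space ::
  "nat \<Rightarrow> nat \<Rightarrow> complex vec set \<Rightarrow> complex vec set \<Rightarrow> complex vec set" where
  "tensor_space p q U V = cspan (p * q) {tensor_vec u v | u v. u \<in> U \<and> v \<in> V}"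

text \<open>
  A basis is given as a family indexed by \<open>{..<n}\<close>; orthonormality forces it to be injective.
\<close>

definition orthonormal_basis :: "nat \<Rightarrow> complex vec set \<Rightarrow> (nat \<Rightarrow> complex vec) \<Rightarrow> bool" where
  "orthonormal_basis n H v \<longleftrightarrow>
     (\<forall>j<n. v j \<in> H) \<and>
     (\<forall>j<n. \<forall>k<n. v j \<bullet>c v k = (if j = k then 1 else 0)) \<and>
     cspan n (v ` {..<n}) = H"

text \<open>
  An array is a function of the row and column index, of which only the values at indices below
  \<open>n\<close> matter. Here \<open>H \<subseteq> carrier_vec n\<close> is the underlying \<open>n\<close>-dimensional space.
\<close>

definition quantum_latin_square ::
  "nat \<Rightarrow> complex vec set \<Rightarrow> (nat \<Rightarrow> nat \<Rightarrow> complex vec) \<Rightarrow> bool" where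
  "quantum_latin_square n H L \<longleftrightarrow>
     (\<forall>i<n. orthonormal_basis n H (\<lambda>j. L i j)) \<and>
     (\<forall>j<n. orthonormal_basis n H (\<lambda>i. L i j))"

definition same_up_to_phase :: "complex vec \<Rightarrow> complex vec \<Rightarrow> bool" where
  "same_up_to_phase u v \<longleftrightarrow> (\<exists>\<theta>::real. u = cis \<theta> \<cdot>\<^sub>v v)"

definition qls_entries :: "nat \<Rightarrow> (nat \<Rightarrow> nat \<Rightarrow> complex vec) \<Rightarrow> complex vec set" where
  "qls_entries n L = {L i j | i j. i < n \<and> j < n}"

definition qls_cardinality :: "nat \<Rightarrow> (nat \<Rightarrow> nat \<Rightarrow> complex vec) \<Rightarrow> nat" where
  "qls_cardinality n L =
     card (qls_entries n L //
       {(u, v). u \<in> qls_entries n L \<and> v \<in> qls_entries n L \<and> same_up_to_phase u v})"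

lemma same_up_to_phase_equiv:
  "equiv A {(u, v). u \<in> A \<and> v \<in> A \<and> same_up_to_phase u v}"
proof (intro equivI refl_onI symI transI)
  show "{(u, v). u \<in> A \<and> v \<in> A \<and> same_up_to_phase u v} \<subseteq> A \<times> A" by auto
next
  fix x assume "x \<in> A"
  moreover have "x = cis 0 \<cdot>\<^sub>v x" by simp
  ultimately show "(x, x) \<in> {(u, v). u \<in> A \<and> v \<in> A \<and> same_up_to_phase u v}"
    unfolding same_up_to_phase_def by blast
next
  fix x y assume "(x, y) \<in> {(u, v). u \<in> A \<and> v \<in> A \<and> same_up_to_phase u v}"
  then obtain t where *: "x \<in> A" "y \<in> A" "x = cis t \<cdot>\<^sub>v y"
    unfolding same_up_to_phase_def by auto
  have "y = cis (- t) \<cdot>\<^sub>v x"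
    unfolding *(3) by (simp add: smult_smult_assoc cis_mult)
  with * show "(y, x) \<in> {(u, v). u \<in> A \<and> v \<in> A \<and> same_up_to_phase u v}"
    unfolding same_up_to_phase_def by blast
next
  fix x y z
  assume "(x, y) \<in> {(u, v). u \<in> A \<and> v \<in> A \<and> same_up_to_phase u v}"
    and "(y, z) \<in> {(u, v). u \<in> A \<and> v \<in> A \<and> same_up_to_phase u v}"
  then obtain s t where *: "x \<in> A" "z \<in> A" "x = cis s \<cdot>\<^sub>v y" "y = cis t \<cdot>\<^sub>v z"
    unfolding same_up_to_phase_def by auto
  have "x = cis (s + t) \<cdot>\<^sub>v z"
    unfolding *(3,4) by (simp add: smult_smult_assoc cis_mult)
  with * show "(x, z) \<in> {(u, v). u \<in> A \<and> v \<in> A \<and> same_up_to_phase u v}"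
    unfolding same_up_to_phase_def by blast
qed

lemma tensor_vec_carrier:
  "u \<in> carrier_vec p \<Longrightarrow> v \<in> carrier_vec q \<Longrightarrow> tensor_vec u v \<in> carrier_vec (p * q)"
  by (rule carrier_vecI) (simp add: tensor_vec_def carrier_vecD)

lemma sum_div_mod:
  fixes f :: "nat \<Rightarrow> nat \<Rightarrow> complex"
  shows "(\<Sum>k<p * q. f (k div q) (k mod q)) = (\<Sum>a<p. \<Sum>b<q. f a b)"
proof -
  have "(\<Sum>a<p. \<Sum>b<q. f a b) = (\<Sum>(a, b)\<in>{..<p} \<times> {..<q}. f a b)"
    by (simp add: sum.cartesian_product)
  also have "\<dots> = (\<Sum>k<p * q. f (k div q) (k mod q))"
  proof (rule sum.reindex_bij_witness[where i = "\<lambda>k. (k div q, k mod q)" and j = "\<lambda>(a, b). a * q + b"])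
    fix x assume "x \<in> {..<p} \<times> {..<q}"
    then obtain a b where x: "x = (a, b)" "a < p" "b < q" by auto
    have "a * q + b < Suc a * q" using x by simp
    also have "\<dots> \<le> p * q" using x by (intro mult_right_mono) auto
    finally show "(case x of (a, b) \<Rightarrow> a * q + b) \<in> {..<p * q}" using x by simp
  next
    fix k assume k: "k \<in> {..<p * q}"
    then have "0 < q" by (intro gr0I) simp
    with k show "(k div q, k mod q) \<in> {..<p} \<times> {..<q}"
      by (auto simp: less_mult_imp_div_less)
  qed auto
  finally show ?thesis by simp
qed

lemma tensor_vec_cscalar_prod:
  assumes "u \<in> carrier_vec p" "u' \<in> carrier_vec p" "v \<in> carrier_vec q" "v' \<in> carrier_vec q"
  shows "tensor_vec u v \<bullet>c tensor_vec u' v' = (u \<bullet>c u') * (v \<bullet>c v')"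
proof -
  have d: "dim_vec u = p" "dim_vec u' = p" "dim_vec v = q" "dim_vec v' = q"
    using assms by (blast dest: carrier_vecD)+
  have bnd: "k div q < p \<and> k mod q < q" if "k < p * q" for k
  proof -
    have "q \<noteq> 0" using that by (intro notI) simp
    then show ?thesis using less_mult_imp_div_less[OF that] by simp
  qed
  have "tensor_vec u v \<bullet>c tensor_vec u' v' =
      (\<Sum>k<p * q. (u $ (k div q) * cnj (u' $ (k div q))) * (v $ (k mod q) * cnj (v' $ (k mod q))))"
    unfolding scalar_prod_def
    by (intro sum.cong) (simp_all add: tensor_vec_def d bnd atLeast0LessThan)
  also have "\<dots> = (\<Sum>a<p. \<Sum>b<q. (u $ a * cnj (u' $ a)) * (v $ b * cnj (v' $ b)))"
    by (rule sum_div_mod[where f = "\<lambda>a b. (u $ a * cnj (u' $ a)) * (v $ b * cnj (v' $ b))"])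
  also have "\<dots> = (u \<bullet>c u') * (v \<bullet>c v')"
    unfolding scalar_prod_def sum_product
    by (intro sum.cong refl) (simp_all add: d atLeast0LessThan)
  finally show ?thesis .
qed

lemma tensor_space_carrier:
  "tensor_space p q (carrier_vec p) (carrier_vec q) = carrier_vec (p * q)"
proof -
  interpret vec_space "TYPE(complex)" "p * q" .
  let ?T = "{tensor_vec u v | u v. u \<in> carrier_vec p \<and> v \<in> carrier_vec q}"
  have T: "?T \<subseteq> carrier_vec (p * q)" by (auto intro: tensor_vec_carrier)
  have "set (unit_vecs (p * q)) \<subseteq> ?T"
  proof
    fix x :: "complex vec" assume "x \<in> set (unit_vecs (p * q))"
    then obtain k where k: "k < p * q" "x = unit_vec (p * q) k" by (auto simp: unit_vecs_def)
    then have q: "0 < q" by (intro gr0I) simp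
    have "x = tensor_vec (unit_vec p (k div q)) (unit_vec q (k mod q))"
    proof (rule eq_vecI)
      fix i assume "i < dim_vec (tensor_vec (unit_vec p (k div q)) (unit_vec q (k mod q)))"
      then have i: "i < p * q" by (simp add: tensor_vec_def)
      have "i = k" if "i div q = k div q" "i mod q = k mod q"
      proof -
        have "i = i div q * q + i mod q" by (rule div_mult_mod_eq[symmetric])
        also have "\<dots> = k div q * q + k mod q" by (simp only: that)
        also have "\<dots> = k" by (rule div_mult_mod_eq)
        finally show ?thesis .
      qed
      then have "i = k \<longleftrightarrow> i div q = k div q \<and> i mod q = k mod q" by blast
      moreover have "i div q < p" "k div q < p" "i mod q < q" "k mod q < q"
        using less_mult_imp_div_less[OF i] less_mult_imp_div_less[OF k(1)] q by simp_all
      ultimately show "x $ i = tensor_vec (unit_vec p (k div q)) (unit_vec q (k mod q)) $ i"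
        using i k(1) unfolding k(2) by (simp add: tensor_vec_def unit_vec_def)
    qed (simp add: k tensor_vec_def)
    then show "x \<in> ?T" using unit_vec_carrier by blast
  qed
  then have "span (set (unit_vecs (p * q))) \<subseteq> span ?T" by (rule span_is_monotone)
  moreover have "span ?T \<subseteq> carrier_vec (p * q)" using T by (rule span_is_subset2)
  ultimately show ?thesis
    unfolding tensor_space_def using span_unit_vecs_is_carrier by auto
qed

end

theory Submission
  imports Defs
begin

text \<open>
  View \<open>\<complex>\<^sup>4\<^sup>m\<close> as \<open>\<complex>\<^sup>m \<otimes> \<complex>\<^sup>4\<close> and cut the array into \<open>4 \<times> 4\<close> blocks. Block \<open>(a, b)\<close> carries
  \<open>e\<^sub>k \<otimes> D\<^sub>a T\<close>, where \<open>k = (a + b) mod m\<close>, the array \<open>T = T\<^sub>k\<^sub>,\<^sub>a\<close> is a quantum Latin square of order 4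
  with real entries and \<open>D\<^sub>a = diag(1, 1, \<omega>, \<omega>\<^sup>2)\<close> with \<open>\<omega> = exp(\<i> a / m)\<close>. A vector of \<open>D\<^sub>a T\<close> can agree up to
  phase with a vector of \<open>D\<^sub>a\<^sub>' T'\<close>, \<open>a \<noteq> a'\<close>, only if \<open>D\<^sub>a\<close> fixes it up to phase. So, if the fixed vectors of
  all \<open>T\<^sub>k\<^sub>,\<^sub>a\<close> occur in \<open>T\<^sub>k\<^sub>,\<^sub>0\<close>, every block with \<open>a > 0\<close> contributes its non-fixed vectors to the cardinality,
  independently of the other blocks. The square \<open>T\<^sub>k\<^sub>,\<^sub>0\<close> can have cardinality 4 or 16, the contribution of
  every other block can be any of 0, 2, 3, 4, 5, 8, 12, 14, 15, 16, and this reaches every cardinality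
  except, for \<open>m = 2\<close>, the value 57 = 16 + 10 + 16 + 15, which uses a contribution 10 that is possible only
  next to a first block of cardinality 16.
\<close>

subsection \<open>Real quantum Latin squares of order four\<close>

text \<open>
  Lines are represented by integer vectors; the first nonzero coordinate is positive and some
  coordinate is a unit, so that distinct primitive vectors span distinct lines.
\<close>

definition primitive :: "int list \<Rightarrow> bool" where
  "primitive z \<longleftrightarrow> (\<exists>p<4. 0 < z ! p \<and> (\<forall>x<p. z ! x = 0)) \<and> (\<exists>p<4. \<bar>z ! p\<bar> = 1)"

definition dot :: "int list \<Rightarrow> int list \<Rightarrow> int" where
  "dot z w = (\<Sum>x<4. z ! x * w ! x)"

text \<open>Entries stay unnormalised integer vectors, so that all conditions can be decided by
  evaluation; lengths are normalised only in \<open>ray_vec\<close>.\<close>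

definition real_qls4 :: "int list list list \<Rightarrow> bool" where
  "real_qls4 t \<longleftrightarrow> length t = 4 \<and> (\<forall>\<alpha><4. length (t ! \<alpha>) = 4) \<and>
     (\<forall>\<alpha><4. \<forall>\<beta><4. length (t ! \<alpha> ! \<beta>) = 4 \<and> primitive (t ! \<alpha> ! \<beta>)) \<and>
     (\<forall>\<alpha><4. \<forall>\<beta><4. \<forall>\<gamma><4. \<beta> \<noteq> \<gamma> \<longrightarrow>
        dot (t ! \<alpha> ! \<beta>) (t ! \<alpha> ! \<gamma>) = 0 \<and> dot (t ! \<beta> ! \<alpha>) (t ! \<gamma> ! \<alpha>) = 0)"

text \<open>The exponents of \<open>\<omega>\<close> in \<open>diag(1, 1, \<omega>, \<omega>\<^sup>2)\<close>.\<close>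

definition weight :: "nat \<Rightarrow> nat" where
  "weight x = [0, 0, 1, 2] ! x"

text \<open>The support lies in one weight space, so \<open>z\<close> is an eigenvector of diag(1,
  1, \<omega>, \<omega>^2) for every \<omega>. The nonzero ones are multiples of axis vectors and
  vectors in the plane of the first two axes.\<close>

definition invariant :: "int list \<Rightarrow> bool" where
  "invariant z \<longleftrightarrow> (\<forall>x<4. \<forall>y<4. z ! x \<noteq> 0 \<longrightarrow> z ! y \<noteq> 0 \<longrightarrow> weight x = weight y)"

definition rays :: "int list list list \<Rightarrow> int list set" where
  "rays t = set (concat t)"

definition moving :: "int list list list \<Rightarrow> int list set" where
  "moving t = set (filter (\<lambda>z. \<not> invariant z) (concat t))"

definition fixed :: "int list list list \<Rightarrow> int list set" where
  "fixed t = set (filter invariant (concat t))"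

text \<open>Columns combine \<open>a\<close>, \<open>b\<close> with \<open>c'\<close>,
  \<open>d'\<close>, and \<open>c\<close>, \<open>d\<close> with \<open>a'\<close>,
  \<open>b'\<close>. Two orthogonal bases thus give a quantum Latin square when \<open>a\<close>,
  \<open>b\<close> and \<open>a'\<close>, \<open>b'\<close> span the same plane. Equal bases give
  the Klein four-group table.\<close>

definition blocks :: "'a \<Rightarrow> 'a \<Rightarrow> 'a \<Rightarrow> 'a \<Rightarrow> 'a \<Rightarrow> 'a \<Rightarrow> 'a \<Rightarrow> 'a \<Rightarrow> 'a list list" where
  "blocks a b c d a' b' c' d' =
     [[a, b, c, d], [b, a, d, c], [c', d', a', b'], [d', c', b', a']]"

abbreviation klein :: "'a \<Rightarrow> 'a \<Rightarrow> 'a \<Rightarrow> 'a \<Rightarrow> 'a list list" where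
  "klein a b c d \<equiv> blocks a b c d a b c d"

definition axis_table :: "int list list list" where
  "axis_table = klein [1,0,0,0] [0,1,0,0] [0,0,1,0] [0,0,0,1]"

text \<open>
  The squares with 16 lines are multiplication tables, \<open>p\<^sub>\<alpha> q\<^sub>\<beta>\<close> or \<open>q\<^sub>\<beta> p\<^sub>\<alpha>\<close>, of two orthogonal bases
  of the quaternions: left and right multiplication by a unit quaternion are isometries.
\<close>

definition dense_table :: "int list list list" where
  "dense_table =
    [[[1,0,0,0], [0,0,1,-1], [0,0,1,1], [0,1,0,0]],
     [[0,1,-1,0], [1,-1,-1,-1], [1,1,1,-1], [1,0,0,1]],
     [[0,1,1,0], [1,-1,1,1], [1,1,-1,1], [1,0,0,-1]],
     [[0,0,0,1], [1,1,0,0], [1,-1,0,0], [0,0,1,0]]]"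

definition table15 :: "int list list list" where
  "table15 =
    [[[0,1,0,0], [1,0,-1,-1], [1,0,0,1], [1,0,2,-1]],
     [[1,0,-1,1], [2,-1,2,0], [1,2,0,-1], [1,-2,-2,-3]],
     [[1,0,-1,-2], [1,4,1,0], [1,-1,3,-1], [5,-1,-1,3]],
     [[1,0,1,0], [1,0,-1,2], [1,-1,-1,-1], [1,3,-1,-1]]]"

text \<open>Each square is paired with its number of moving lines. Its fixed lines are all axes,
  which both possible first blocks contain. \<open>dense_table\<close>, with 10 moving lines, is
  absent because it also fixes (1,1,0,0) and (1,-1,0,0).\<close>

definition increment_tables :: "(nat \<times> int list list list) list" where
  "increment_tables =
    [(0, axis_table),
     (2, klein [1,0,0,0] [0,0,1,0] [0,1,0,1] [0,1,0,-1]),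
     (3, klein [1,0,0,0] [0,1,1,1] [0,1,-1,0] [0,1,1,-2]),
     (4, klein [1,1,1,1] [1,1,-1,-1] [1,-1,1,-1] [1,-1,-1,1]),
     (5, blocks [1,0,0,0] [0,1,1,1] [0,1,-1,0] [0,1,1,-2]
                [1,0,0,0] [0,1,1,1] [0,1,0,-1] [0,1,-2,1]),
     (8, blocks [1,0,1,0] [0,1,0,1] [1,0,-1,0] [0,1,0,-1]
                [1,1,1,1] [1,-1,1,-1] [1,1,-1,-1] [1,-1,-1,1]),
     (12,
      [[[1,0,0,0], [0,1,0,-1], [0,1,0,1], [0,0,1,0]],
       [[0,1,-1,0], [1,-1,-1,-1], [1,1,1,-1], [1,0,0,1]],
       [[0,1,1,0], [1,1,-1,1], [1,-1,1,1], [1,0,0,-1]],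
       [[0,0,0,1], [1,0,1,0], [1,0,-1,0], [0,1,0,0]]]),
     (14,
      [[[0,0,1,0], [0,1,0,1], [1,1,0,-1], [2,-1,0,1]],
       [[0,1,0,0], [1,0,1,0], [1,0,-1,1], [1,0,-1,-2]],
       [[1,0,0,-1], [1,-1,-1,1], [1,0,2,1], [1,3,-1,1]],
       [[1,0,0,1], [1,1,-1,-1], [1,-2,0,-1], [1,1,3,-1]]]),
     (15, table15),
     (16,
      [[[1,1,1,0], [0,1,-1,1], [1,0,-1,-1], [1,-1,0,1]],
       [[1,-1,0,-1], [1,0,1,1], [0,1,1,-1], [1,1,-1,0]],
       [[0,1,-1,-1], [1,-1,-1,0], [1,1,0,1], [1,0,1,-1]],
       [[1,0,-1,1], [1,1,0,-1], [1,-1,1,0], [0,1,1,1]]])]"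

lemma all_less_4: "(\<forall>x<4. P x) \<longleftrightarrow> P 0 \<and> P 1 \<and> P 2 \<and> P (3::nat)"
  by (auto simp: numeral_eq_Suc less_Suc_eq)

lemmas ray_simps = axis_table_def dense_table_def table15_def increment_tables_def blocks_def
  rays_def moving_def fixed_def invariant_def weight_def all_less_4

lemma real_qls4_dense_table: "real_qls4 dense_table"
  by code_simp

lemma increment_tables:
  assumes "(s, t) \<in> set increment_tables"
  shows "real_qls4 t" "card (moving t) = s" "fixed t \<subseteq> rays axis_table"
proof -
  have "\<forall>(s, t) \<in> set increment_tables. real_qls4 t"
    by code_simp
  with assms show "real_qls4 t" by blast
  have "\<forall>(s, t) \<in> set increment_tables. card (moving t) = s"
    by (simp add: ray_simps card_insert_if del: set_filter set_concat)
  with assms show "card (moving t) = s" by blast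
  have "\<forall>(s, t) \<in> set increment_tables. fixed t \<subseteq> rays axis_table"
    by (simp add: ray_simps del: set_filter set_concat)
  with assms show "fixed t \<subseteq> rays axis_table" by blast
qed

lemma axis_table: "rays axis_table \<subseteq> rays dense_table" "card (rays axis_table) = 4"
  by (simp_all add: ray_simps card_insert_if del: set_concat)

lemma dense_table: "card (rays dense_table) = 16" "card (moving dense_table) = 10"
  by (simp_all add: ray_simps card_insert_if del: set_filter set_concat)

subsection \<open>Rays and phases\<close>

text \<open>Proportional vectors have their first nonzero entry at the same position. The unit
  coordinates make these leading entries divide each other, and positivity makes them equal.\<close>

lemma primitive_unique:
  assumes z: "primitive z" "length z = 4" and w: "primitive w" "length w = 4"
    and parallel: "\<And>x y. x < 4 \<Longrightarrow> y < 4 \<Longrightarrow> z ! x * w ! y = w ! x * z ! y"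
  shows "z = w"
proof -
  obtain p where p: "p < 4" "0 < z ! p" "\<And>x. x < p \<Longrightarrow> z ! x = 0"
    using z(1) by (auto simp: primitive_def)
  obtain q where q: "q < 4" "0 < w ! q" "\<And>x. x < q \<Longrightarrow> w ! x = 0"
    using w(1) by (auto simp: primitive_def)
  have "\<not> p < q"
    using parallel[OF p(1) q(1)] p(2) q(2,3) by auto
  moreover have "\<not> q < p"
    using parallel[OF p(1) q(1)] q(2) p(2,3) by auto
  ultimately have [simp]: "q = p" by simp
  obtain x where x: "x < 4" "\<bar>z ! x\<bar> = 1"
    using z(1) by (auto simp: primitive_def)
  obtain y where y: "y < 4" "\<bar>w ! y\<bar> = 1"
    using w(1) by (auto simp: primitive_def)
  have "z ! p dvd w ! p * z ! x"
    by (metis parallel[OF p(1) x(1)] dvd_triv_left)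
  then have "z ! p dvd w ! p"
    using x(2) by (auto simp: abs_eq_iff')
  moreover have "w ! p dvd z ! p * w ! y"
    by (metis parallel[OF p(1) y(1)] dvd_triv_left)
  then have "w ! p dvd z ! p"
    using y(2) by (auto simp: abs_eq_iff')
  ultimately have "z ! p = w ! p"
    using p(2) q(2) by (simp add: zdvd_antisym_nonneg)
  then have "z ! x = w ! x" if "x < 4" for x
    using parallel[OF p(1) that] p(2) by simp
  then show ?thesis
    using z(2) w(2) by (simp add: list_eq_iff_nth_eq)
qed

lemma dot_self_pos:
  assumes "primitive z"
  shows "0 < dot z z"
proof -
  obtain p where p: "p < 4" "0 < z ! p"
    using assms by (auto simp: primitive_def)
  then have "0 < z ! p * z ! p" by simp
  also have "\<dots> \<le> dot z z"
    unfolding dot_def using p(1) by (intro member_le_sum) auto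
  finally show ?thesis .
qed

text \<open>The unit vector along \<open>z\<close>, multiplied by diag(1, 1, \<omega>, \<omega>^2)
  with \<omega> = exp(i t).\<close>

definition ray_vec :: "real \<Rightarrow> int list \<Rightarrow> complex vec" where
  "ray_vec t z = vec 4 (\<lambda>x.
     complex_of_real (real_of_int (z ! x) / sqrt (real_of_int (dot z z))) * cis (t * real (weight x)))"

lemma ray_vec_carrier [simp]: "ray_vec t z \<in> carrier_vec 4"
  by (simp add: ray_vec_def)

lemma ray_vec_cscalar_prod:
  "ray_vec t z \<bullet>c ray_vec t w =
     complex_of_real (real_of_int (dot z w) / (sqrt (real_of_int (dot z z)) * sqrt (real_of_int (dot w w))))"
proof -
  have "ray_vec t z \<bullet>c ray_vec t w =
      (\<Sum>x<4. complex_of_real (real_of_int (z ! x * w ! x) /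
        (sqrt (real_of_int (dot z z)) * sqrt (real_of_int (dot w w)))))"
    unfolding scalar_prod_def atLeast0LessThan
  proof (rule sum.cong)
    fix x assume "x \<in> {..<4::nat}"
    moreover have "cis \<theta> * cnj (cis \<theta>) = 1" for \<theta>
      by (simp add: cis_cnj cis_mult)
    ultimately show "ray_vec t z $ x * conjugate (ray_vec t w) $ x =
        complex_of_real (real_of_int (z ! x * w ! x) /
        (sqrt (real_of_int (dot z z)) * sqrt (real_of_int (dot w w))))"
      by (simp add: ray_vec_def)
  qed (simp add: ray_vec_def)
  also have "\<dots> = complex_of_real (\<Sum>x<4. real_of_int (z ! x * w ! x) /
        (sqrt (real_of_int (dot z z)) * sqrt (real_of_int (dot w w))))"
    by (rule of_real_sum[symmetric])
  also have "\<dots> = complex_of_real (real_of_int (dot z w) /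
        (sqrt (real_of_int (dot z z)) * sqrt (real_of_int (dot w w))))"
    unfolding dot_def of_int_sum by (simp add: sum_divide_distrib)
  finally show ?thesis .
qed

lemma unit_vec_cscalar_prod:
  assumes "k < m" "l < m"
  shows "unit_vec m k \<bullet>c (unit_vec m l :: complex vec) = (if k = l then 1 else 0)"
proof -
  have "conjugate (unit_vec m l :: complex vec) = unit_vec m l"
    by (intro eq_vecI) (auto simp: unit_vec_def)
  then show ?thesis
    using assms by auto
qed

lemma tensor_unit_vec_index:
  assumes "v \<in> carrier_vec 4" "j < m" "x < 4"
  shows "tensor_vec (unit_vec m k) v $ (j * 4 + x) = (if j = k then v $ x else 0)"
proof -
  have "j * 4 + x < m * 4" using assms by linarith
  with assms show ?thesis
    by (auto simp: tensor_vec_def unit_vec_def)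
qed

lemma tensor_vec_smult:
  "tensor_vec u (c \<cdot>\<^sub>v v) = c \<cdot>\<^sub>v tensor_vec u v"
proof (rule eq_vecI)
  fix x assume "x < dim_vec (c \<cdot>\<^sub>v tensor_vec u v)"
  then have x: "x < dim_vec u * dim_vec v" by (simp add: tensor_vec_def)
  then have "x mod dim_vec v < dim_vec v" by (intro mod_less_divisor gr0I) simp
  with x show "tensor_vec u (c \<cdot>\<^sub>v v) $ x = (c \<cdot>\<^sub>v tensor_vec u v) $ x"
    by (simp add: tensor_vec_def mult.left_commute)
qed (simp add: tensor_vec_def)

lemma weight_diff_le:
  assumes "x < 4" "y < 4"
  shows "\<bar>real (weight x) - real (weight y)\<bar> \<le> 2"
proof -
  have "\<forall>x<4. weight x \<le> 2" by code_simp
  with assms have "weight x \<le> 2" "weight y \<le> 2" by blast+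
  then show ?thesis by linarith
qed

text \<open>The first tensor factor detects \<open>k\<close>. In the second, two real lines rotated
  by different angles can agree only if the rotation acts on them as a scalar, because the angles
  are too small for relative phases to reach -1.\<close>

lemma same_ray_iff:
  assumes z: "primitive z" "length z = 4" and w: "primitive w" "length w = 4"
    and st: "0 \<le> s" "s < 1" "0 \<le> t" "t < 1" and kl: "k < m" "l < m"
  shows "same_up_to_phase (tensor_vec (unit_vec m k) (ray_vec s z)) (tensor_vec (unit_vec m l) (ray_vec t w))
    \<longleftrightarrow> k = l \<and> z = w \<and> (s = t \<or> invariant z)" (is "same_up_to_phase ?u ?v \<longleftrightarrow> _")
proof
  assume "same_up_to_phase ?u ?v"
  then obtain \<phi> where \<phi>: "?u = cis \<phi> \<cdot>\<^sub>v ?v"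
    by (auto simp: same_up_to_phase_def)
  have entry: "ray_vec s z $ x = cis \<phi> * (if k = l then ray_vec t w $ x else 0)" if "x < 4" for x
  proof -
    have "?u $ (k * 4 + x) = (cis \<phi> \<cdot>\<^sub>v ?v) $ (k * 4 + x)" by (simp only: \<phi>)
    moreover have "k * 4 + x < dim_vec ?v"
      using kl that by (simp add: tensor_vec_def ray_vec_def)
    ultimately show ?thesis
      using kl that by (simp add: tensor_unit_vec_index)
  qed
  define a where "a x = real_of_int (z ! x) / sqrt (real_of_int (dot z z))" for x
  define b where "b x = real_of_int (w ! x) / sqrt (real_of_int (dot w w))" for x
  have a0: "a x = 0 \<longleftrightarrow> z ! x = 0" and b0: "b x = 0 \<longleftrightarrow> w ! x = 0" for x
    using dot_self_pos[OF z(1)] dot_self_pos[OF w(1)] by (auto simp: a_def b_def)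
  obtain p where p: "p < 4" "z ! p \<noteq> 0"
    using z(1) by (auto simp: primitive_def)
  have "k = l"
    using entry[OF p(1)] p a0[of p] by (auto simp: ray_vec_def a_def split: if_splits)
  have eq: "a x * cis (s * weight x) = cis \<phi> * (b x * cis (t * weight x))" if "x < 4" for x
    using entry[OF that] \<open>k = l\<close> that by (simp add: ray_vec_def a_def b_def)
  \<comment> \<open>Comparing two coordinates eliminates the unknown global phase.\<close>
  have cross: "a x * b y * cis ((s - t) * (real (weight x) - real (weight y))) = b x * a y"
    if "x < 4" "y < 4" for x y
  proof -
    have "(a x * cis (s * weight x)) * (cis \<phi> * (b y * cis (t * weight y))) =
        (cis \<phi> * (b x * cis (t * weight x))) * (a y * cis (s * weight y))"
      by (simp only: eq[OF that(1)] eq[OF that(2)])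
    then have "cis \<phi> * (a x * b y * cis (s * weight x + t * weight y)) =
        cis \<phi> * (b x * a y * cis (t * weight x + s * weight y))"
      by (simp add: cis_mult[symmetric] mult_ac)
    then have "a x * b y * cis (s * weight x + t * weight y) =
        b x * a y * cis (t * weight x + s * weight y)"
      by simp
    then have "a x * b y * cis (s * weight x + t * weight y) * cis (- (t * weight x + s * weight y)) =
        b x * a y * cis (t * weight x + s * weight y) * cis (- (t * weight x + s * weight y))"
      by simp
    then show ?thesis
      by (simp add: mult.assoc cis_mult algebra_simps)
  qed
  \<comment> \<open>All other factors in \<open>cross\<close> are real, so the sine of the relative
    phase vanishes; its absolute value is below 2, hence below pi, so the phase itself is 0.\<close>
  have weight_eq: "(s - t) * (real (weight x) - real (weight y)) = 0"
    if "x < 4" "y < 4" "z ! x \<noteq> 0" "w ! y \<noteq> 0" for x y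
  proof -
    let ?\<delta> = "(s - t) * (real (weight x) - real (weight y))"
    have "Im (a x * b y * cis ?\<delta>) = 0"
      using cross[OF that(1,2)] by (metis Im_complex_of_real of_real_mult)
    then have "sin ?\<delta> = 0"
      using that a0 b0 by simp
    moreover have "\<bar>?\<delta>\<bar> \<le> \<bar>s - t\<bar> * 2"
      unfolding abs_mult using weight_diff_le[OF that(1,2)] by (intro mult_left_mono) auto
    moreover have "\<bar>s - t\<bar> < 1"
      using st by linarith
    then have "\<bar>s - t\<bar> * 2 < pi"
      using pi_ge_two by simp
    ultimately have "sin ?\<delta> = 0" "\<bar>?\<delta>\<bar> < pi"
      by (blast intro: le_less_trans)+
    then show ?thesis
      by (simp only: abs_less_iff sin_eq_0_pi minus_less_iff)
  qed
  have "z ! x * w ! y = w ! x * z ! y" if "x < 4" "y < 4" for x y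
  proof -
    have "complex_of_real (a x * b y) = of_real (b x * a y)"
    proof (cases "z ! x = 0 \<or> w ! y = 0")
      case True
      then show ?thesis using cross[OF that] a0[of x] b0[of y] by auto
    next
      case False
      then show ?thesis using cross[OF that] weight_eq[OF that] by simp
    qed
    then have "a x * b y = b x * a y" by (simp only: of_real_eq_iff)
    then have "real_of_int (z ! x * w ! y) = real_of_int (w ! x * z ! y)"
      using dot_self_pos[OF z(1)] dot_self_pos[OF w(1)] by (simp add: a_def b_def field_simps)
    then show ?thesis by (simp only: of_int_eq_iff)
  qed
  then have "z = w" by (rule primitive_unique[OF z w])
  moreover have "s = t \<or> invariant z"
    using weight_eq \<open>z = w\<close> by (auto simp: invariant_def)
  ultimately show "k = l \<and> z = w \<and> (s = t \<or> invariant z)"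
    using \<open>k = l\<close> by blast
next
  assume r: "k = l \<and> z = w \<and> (s = t \<or> invariant z)"
  obtain p where p: "p < 4" "z ! p \<noteq> 0"
    using z(1) by (auto simp: primitive_def)
  \<comment> \<open>Unless \<open>s = t\<close>, every coordinate in the support has the weight of
    \<open>p\<close>, so the phase read off at \<open>p\<close> works everywhere.\<close>
  have "ray_vec s z = cis ((s - t) * weight p) \<cdot>\<^sub>v ray_vec t z"
  proof (rule eq_vecI)
    fix x assume "x < dim_vec (cis ((s - t) * weight p) \<cdot>\<^sub>v ray_vec t z)"
    then have x: "x < 4" by (simp add: ray_vec_def)
    show "ray_vec s z $ x = (cis ((s - t) * weight p) \<cdot>\<^sub>v ray_vec t z) $ x"
    proof (cases "z ! x = 0")
      case True
      with x show ?thesis by (simp add: ray_vec_def)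
    next
      case False
      then have "s = t \<or> weight p = weight x"
        using r p x by (auto simp: invariant_def)
      then have "(s - t) * weight p + t * weight x = s * weight x"
        by (auto simp: algebra_simps)
      then have "cis ((s - t) * weight p) * cis (t * weight x) = cis (s * weight x)"
        by (simp only: cis_mult)
      then show ?thesis
        using x by (simp add: ray_vec_def mult.left_commute)
    qed
  qed (simp add: ray_vec_def)
  then show "same_up_to_phase ?u ?v"
    using r tensor_vec_smult unfolding same_up_to_phase_def by metis
qed

subsection \<open>Orthonormal bases and cardinalities\<close>

text \<open>Orthonormality says that \<open>B\<close>, the conjugate transpose of \<open>A\<close>,
  is a left inverse of \<open>A\<close>. For square matrices it is also a right inverse, so each
  \<open>y\<close> is the combination of columns with coefficients
  \<open>B *\<^sub>v y\<close>.\<close>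

lemma cspan_orthonormal:
  assumes carrier: "\<And>j. j < n \<Longrightarrow> v j \<in> carrier_vec n"
    and orth: "\<And>j k. j < n \<Longrightarrow> k < n \<Longrightarrow> v j \<bullet>c v k = (if j = k then 1 else 0)"
  shows "cspan n (v ` {..<n}) = carrier_vec n"
proof -
  interpret vec_space "TYPE(complex)" n .
  define A where "A = mat n n (\<lambda>(x, j). v j $ x)"
  define B where "B = mat n n (\<lambda>(j, x). cnj (v j $ x))"
  have A: "A \<in> carrier_mat n n" and B: "B \<in> carrier_mat n n"
    by (simp_all add: A_def B_def)
  have col: "col A j = v j" if "j < n" for j
    using that carrier[OF that] by (intro eq_vecI) (auto simp: A_def)
  have "B * A = 1\<^sub>m n"
  proof (rule eq_matI)
    fix j k assume jk: "j < dim_row (1\<^sub>m n)" "k < dim_col (1\<^sub>m n)"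
    then have d: "dim_vec (v j) = n" "dim_vec (v k) = n"
      using carrier by auto
    have "(B * A) $$ (j, k) = (\<Sum>x<n. cnj (v j $ x) * v k $ x)"
      using jk by (simp add: A_def B_def scalar_prod_def atLeast0LessThan)
    also have "\<dots> = v k \<bullet>c v j"
      unfolding scalar_prod_def using d by (simp add: atLeast0LessThan mult.commute)
    finally show "(B * A) $$ (j, k) = 1\<^sub>m n $$ (j, k)"
      using orth[of k j] jk by auto
  qed (use A B in auto)
  then have AB: "A * B = 1\<^sub>m n"
    by (rule mat_mult_left_right_inverse[OF B A])
  have "set (cols A) = v ` {..<n}"
    using A col by (auto simp: cols_def)
  then have "span (v ` {..<n}) = {y \<in> carrier_vec n. \<exists>x\<in>carrier_vec n. A *\<^sub>v x = y}"
    using col_space_eq[OF A] A by (simp add: col_space_def)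
  also have "\<dots> = carrier_vec n"
  proof (intro equalityI subsetI)
    fix y :: "complex vec" assume y: "y \<in> carrier_vec n"
    then have "A *\<^sub>v (B *\<^sub>v y) = y"
      using A B AB by (metis assoc_mult_mat_vec one_mult_mat_vec)
    with y B show "y \<in> {y \<in> carrier_vec n. \<exists>x\<in>carrier_vec n. A *\<^sub>v x = y}"
      by (auto intro!: bexI[of _ "B *\<^sub>v y"])
  qed simp
  finally show ?thesis .
qed

lemma orthonormal_basisI:
  assumes "\<And>j. j < n \<Longrightarrow> v j \<in> carrier_vec n"
    and "\<And>j k. j < n \<Longrightarrow> k < n \<Longrightarrow> v j \<bullet>c v k = (if j = k then 1 else 0)"
  shows "orthonormal_basis n (carrier_vec n) v"
  unfolding orthonormal_basis_def using assms cspan_orthonormal[of n v] by auto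

text \<open>The maps \<open>f\<close> and \<open>g\<close> have the same fibres on \<open>J\<close>,
  so sending \<open>f p\<close> to \<open>g p\<close> is a well-defined bijection of the
  images.\<close>

lemma card_image_eqI:
  assumes "\<And>p q. p \<in> J \<Longrightarrow> q \<in> J \<Longrightarrow> f p = f q \<longleftrightarrow> g p = g q"
  shows "card (f ` J) = card (g ` J)"
proof -
  define h where "h y = g (SOME p. p \<in> J \<and> f p = y)" for y
  have h: "h (f p) = g p" if "p \<in> J" for p
    unfolding h_def using someI[of "\<lambda>q. q \<in> J \<and> f q = f p" p] that assms by blast
  have "inj_on h (f ` J)"
    using assms by (auto intro!: inj_onI simp: h)
  moreover have "h ` f ` J = g ` J"
    by (auto simp: h image_iff)
  ultimately show ?thesis
    by (metis card_image)
qed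

text \<open>Counting phase classes is reduced to counting the values of a complete invariant
  \<open>key\<close>.\<close>

lemma qls_cardinality_eqI:
  assumes "\<And>i j i' j'. i < n \<Longrightarrow> j < n \<Longrightarrow> i' < n \<Longrightarrow> j' < n \<Longrightarrow>
      same_up_to_phase (L i j) (L i' j') \<longleftrightarrow> key i j = key i' j'"
  shows "qls_cardinality n L = card {key i j | i j. i < n \<and> j < n}"
proof -
  let ?J = "{..<n} \<times> {..<n}"
  let ?E = "qls_entries n L"
  let ?R = "{(u, v). u \<in> ?E \<and> v \<in> ?E \<and> same_up_to_phase u v}"
  have E: "?E = (\<lambda>(i, j). L i j) ` ?J"
    by (auto simp: qls_entries_def)
  have "f ` J // R = (\<lambda>p. R `` {f p}) ` J" for f :: "nat \<times> nat \<Rightarrow> complex vec" and J R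
    by (auto simp: quotient_def)
  from this[of "\<lambda>(i, j). L i j" ?J ?R]
  have "?E // ?R = (\<lambda>p. ?R `` {case p of (i, j) \<Rightarrow> L i j}) ` ?J"
    by (simp only: E[symmetric])
  moreover have "card \<dots> = card ((\<lambda>(i, j). key i j) ` ?J)"
  proof (rule card_image_eqI)
    fix p q assume pq: "p \<in> ?J" "q \<in> ?J"
    obtain i j i' j' where [simp]: "p = (i, j)" "q = (i', j')"
      by (metis surj_pair)
    have "L i j \<in> ?E" "L i' j' \<in> ?E"
      using pq by (auto simp: E)
    from eq_equiv_class_iff[OF same_up_to_phase_equiv this] assms[of i j i' j'] this pq
    show "?R `` {case p of (i, j) \<Rightarrow> L i j} = ?R `` {case q of (i, j) \<Rightarrow> L i j} \<longleftrightarrow>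
        (case p of (i, j) \<Rightarrow> key i j) = (case q of (i, j) \<Rightarrow> key i j)"
      by simp
  qed
  moreover have "(\<lambda>(i, j). key i j) ` ?J = {key i j | i j. i < n \<and> j < n}"
    by auto
  ultimately show ?thesis
    by (simp add: qls_cardinality_def)
qed

subsection \<open>The block square\<close>

lemma in_fixed_iff: "z \<in> fixed t \<longleftrightarrow> z \<in> rays t \<and> invariant z"
  by (simp add: fixed_def rays_def)

lemma in_moving_iff: "z \<in> moving t \<longleftrightarrow> z \<in> rays t \<and> \<not> invariant z"
  by (simp add: moving_def rays_def)

lemma in_rays_iff:
  assumes "real_qls4 t"
  shows "z \<in> rays t \<longleftrightarrow> (\<exists>\<alpha><4. \<exists>\<beta><4. z = t ! \<alpha> ! \<beta>)"
proof -
  have "z \<in> rays t \<longleftrightarrow> (\<exists>r\<in>set t. z \<in> set r)"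
    by (auto simp: rays_def)
  also have "\<dots> \<longleftrightarrow> (\<exists>\<alpha><length t. z \<in> set (t ! \<alpha>))"
    by (metis in_set_conv_nth)
  also have "\<dots> \<longleftrightarrow> (\<exists>\<alpha><4. \<exists>\<beta><4. z = t ! \<alpha> ! \<beta>)"
    using assms by (simp add: real_qls4_def in_set_conv_nth eq_commute[of _ z] cong: conj_cong)
  finally show ?thesis .
qed

text \<open>The local square is indexed by \<open>k\<close> and the block row, not by the block
  column: lines with different \<open>k\<close> never coincide, so the count splits over
  \<open>k\<close>.\<close>

definition block_square :: "nat \<Rightarrow> (nat \<Rightarrow> nat \<Rightarrow> int list list list) \<Rightarrow> nat \<Rightarrow> nat \<Rightarrow> complex vec" where
  "block_square m T i j =
     (let a = i div 4; k = (a + j div 4) mod m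
      in tensor_vec (unit_vec m k) (ray_vec (real a / real m) (T k a ! (i mod 4) ! (j mod 4))))"

lemma add_mod_inj:
  fixes a b c m :: nat
  assumes "a < m" "b < m" "c < m"
  shows "(a + b) mod m = (a + c) mod m \<longleftrightarrow> b = c"
proof -
  have "(a + x) mod m = (if a + x < m then a + x else a + x - m)" if "x < m" for x
    using that assms(1) by (simp add: le_mod_geq)
  then show ?thesis
    using assms by (auto split: if_splits)
qed

lemma block_square_carrier: "block_square m T i j \<in> carrier_vec (4 * m)"
  unfolding block_square_def Let_def mult.commute[of 4 m]
  by (intro tensor_vec_carrier unit_vec_carrier ray_vec_carrier)

lemma block_square_cscalar_prod:
  fixes i j i' j' m :: nat
  defines "k \<equiv> (i div 4 + j div 4) mod m" and "l \<equiv> (i' div 4 + j' div 4) mod m"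
  assumes "0 < m"
  shows "block_square m T i j \<bullet>c block_square m T i' j' =
    (if k = l then ray_vec (real (i div 4) / real m) (T k (i div 4) ! (i mod 4) ! (j mod 4)) \<bullet>c
       ray_vec (real (i' div 4) / real m) (T l (i' div 4) ! (i' mod 4) ! (j' mod 4)) else 0)"
  unfolding block_square_def Let_def k_def l_def
  by (simp add: tensor_vec_cscalar_prod[OF unit_vec_carrier unit_vec_carrier
        ray_vec_carrier ray_vec_carrier] unit_vec_cscalar_prod assms(3))

lemma ray_vec_unit:
  assumes "primitive z"
  shows "ray_vec s z \<bullet>c ray_vec s z = 1"
  using dot_self_pos[OF assms] by (simp add: ray_vec_cscalar_prod flip: of_real_mult)

lemma ray_vec_orthogonal:
  assumes "dot z w = 0"
  shows "ray_vec s z \<bullet>c ray_vec s w = 0"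
  using assms by (simp add: ray_vec_cscalar_prod)

lemma ray_vec_orthonormal:
  assumes "real_qls4 t" "\<alpha> < 4" "\<beta> < 4" "\<gamma> < 4"
  shows "ray_vec s (t ! \<alpha> ! \<beta>) \<bullet>c ray_vec s (t ! \<alpha> ! \<gamma>) = (if \<beta> = \<gamma> then 1 else 0)"
    and "ray_vec s (t ! \<beta> ! \<alpha>) \<bullet>c ray_vec s (t ! \<gamma> ! \<alpha>) = (if \<beta> = \<gamma> then 1 else 0)"
proof -
  have p: "primitive (t ! \<alpha> ! \<beta>)" "primitive (t ! \<beta> ! \<alpha>)"
    using assms by (auto simp: real_qls4_def)
  have o: "dot (t ! \<alpha> ! \<beta>) (t ! \<alpha> ! \<gamma>) = 0" "dot (t ! \<beta> ! \<alpha>) (t ! \<gamma> ! \<alpha>) = 0" if "\<beta> \<noteq> \<gamma>"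
    using assms that by (auto simp: real_qls4_def)
  show "ray_vec s (t ! \<alpha> ! \<beta>) \<bullet>c ray_vec s (t ! \<alpha> ! \<gamma>) = (if \<beta> = \<gamma> then 1 else 0)"
    using ray_vec_unit[OF p(1)] ray_vec_orthogonal[OF o(1)] by (cases "\<beta> = \<gamma>") simp_all
  show "ray_vec s (t ! \<beta> ! \<alpha>) \<bullet>c ray_vec s (t ! \<gamma> ! \<alpha>) = (if \<beta> = \<gamma> then 1 else 0)"
    using ray_vec_unit[OF p(2)] ray_vec_orthogonal[OF o(2)] by (cases "\<beta> = \<gamma>") simp_all
qed

lemma div_mod_eq_iff:
  fixes i j n :: nat
  shows "i div n = j div n \<and> i mod n = j mod n \<longleftrightarrow> i = j"
  by (metis div_mult_mod_eq)

text \<open>Entries of one row or column in different blocks have different \<open>k\<close> and are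
  orthogonal in the first tensor factor. Within one block they carry the same diagonal unitary,
  which preserves the orthogonality of the local square.\<close>

lemma block_square_qls:
  assumes "0 < m" and T: "\<And>k a. k < m \<Longrightarrow> a < m \<Longrightarrow> real_qls4 (T k a)"
  shows "quantum_latin_square (4 * m) (carrier_vec (4 * m)) (block_square m T)"
  unfolding quantum_latin_square_def
proof (intro conjI allI impI)
  fix i assume i: "i < 4 * m"
  then have a: "i div 4 < m" by auto
  show "orthonormal_basis (4 * m) (carrier_vec (4 * m)) (block_square m T i)"
  proof (rule orthonormal_basisI[OF block_square_carrier])
    fix j j' assume j: "j < 4 * m" "j' < 4 * m"
    then have b: "j div 4 < m" "j' div 4 < m" by auto
    have "real_qls4 (T ((i div 4 + j div 4) mod m) (i div 4))"
      using T assms(1) a by simp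
    then show "block_square m T i j \<bullet>c block_square m T i j' = (if j = j' then 1 else 0)"
      using add_mod_inj[OF a b] div_mod_eq_iff[of j 4 j']
      by (auto simp: block_square_cscalar_prod assms(1) ray_vec_orthonormal)
  qed
next
  fix j assume j: "j < 4 * m"
  then have b: "j div 4 < m" by auto
  show "orthonormal_basis (4 * m) (carrier_vec (4 * m)) (\<lambda>i. block_square m T i j)"
  proof (rule orthonormal_basisI[OF block_square_carrier])
    fix i i' assume i: "i < 4 * m" "i' < 4 * m"
    then have a: "i div 4 < m" "i' div 4 < m" by auto
    have "real_qls4 (T ((i div 4 + j div 4) mod m) (i div 4))"
      using T assms(1) a by simp
    then show "block_square m T i j \<bullet>c block_square m T i' j = (if i = i' then 1 else 0)"
      using add_mod_inj[OF b a] div_mod_eq_iff[of i 4 i']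
      by (auto simp: block_square_cscalar_prod assms(1) ray_vec_orthonormal add.commute[of "j div 4"])
  qed
qed

text \<open>For each \<open>k\<close>, block row 0 supplies all its lines, including by assumption
  every fixed line of the later rows. Each later row then adds exactly its moving lines, which are
  new.\<close>

lemma block_square_cardinality:
  assumes "0 < m" and T: "\<And>k a. k < m \<Longrightarrow> a < m \<Longrightarrow> real_qls4 (T k a)"
    and fixed: "\<And>k a. k < m \<Longrightarrow> a < m \<Longrightarrow> fixed (T k a) \<subseteq> rays (T k 0)"
  shows "qls_cardinality (4 * m) (block_square m T) =
    (\<Sum>k<m. card (rays (T k 0)) + (\<Sum>a<m - 1. card (moving (T k (Suc a)))))"
proof -
  define ray where "ray i j = T ((i div 4 + j div 4) mod m) (i div 4) ! (i mod 4) ! (j mod 4)" for i j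
  \<comment> \<open>An invariant line does not remember its block row. The label 0 fits because such
    a line also occurs in the local square of block row 0.\<close>
  define key where "key i j =
    ((i div 4 + j div 4) mod m, if invariant (ray i j) then 0 else i div 4, ray i j)" for i j
  define R where "R k a = (if a = 0 then rays (T k 0) else moving (T k a))" for k a
  have ray: "primitive (ray i j)" "length (ray i j) = 4"
    "ray i j \<in> rays (T ((i div 4 + j div 4) mod m) (i div 4))" if "i < 4 * m" "j < 4 * m" for i j
  proof -
    have "real_qls4 (T ((i div 4 + j div 4) mod m) (i div 4))"
      using T assms(1) that by auto
    moreover have "i mod 4 < 4" "j mod 4 < 4" by simp_all
    ultimately show "primitive (ray i j)" "length (ray i j) = 4"
      "ray i j \<in> rays (T ((i div 4 + j div 4) mod m) (i div 4))"
      unfolding ray_def using in_rays_iff by (simp_all add: real_qls4_def, blast)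
  qed
  have "qls_cardinality (4 * m) (block_square m T) = card {key i j | i j. i < 4 * m \<and> j < 4 * m}"
  proof (rule qls_cardinality_eqI)
    fix i j i' j' assume ij: "i < 4 * m" "j < 4 * m" "i' < 4 * m" "j' < 4 * m"
    then have "real (i div 4) / real m < 1" "real (i' div 4) / real m < 1"
      by (auto simp: divide_less_eq_1)
    moreover have "real (i div 4) / real m = real (i' div 4) / real m \<longleftrightarrow> i div 4 = i' div 4"
      using assms(1) by auto
    ultimately show "same_up_to_phase (block_square m T i j) (block_square m T i' j') \<longleftrightarrow> key i j = key i' j'"
      using same_ray_iff[OF ray(1,2)[OF ij(1,2)] ray(1,2)[OF ij(3,4)],
          of "real (i div 4) / real m" "real (i' div 4) / real m"
            "(i div 4 + j div 4) mod m" m "(i' div 4 + j' div 4) mod m"] assms(1)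
      by (auto simp: block_square_def Let_def key_def ray_def[symmetric])
  qed
  also have "{key i j | i j. i < 4 * m \<and> j < 4 * m} = Sigma {..<m} (\<lambda>k. Sigma {..<m} (R k))"
  proof (intro equalityI subsetI)
    fix x assume "x \<in> {key i j | i j. i < 4 * m \<and> j < 4 * m}"
    then obtain i j where x: "x = key i j" and ij: "i < 4 * m" "j < 4 * m" by blast
    have k: "(i div 4 + j div 4) mod m < m" and a: "i div 4 < m"
      using assms(1) ij by auto
    show "x \<in> Sigma {..<m} (\<lambda>k. Sigma {..<m} (R k))"
    proof (cases "invariant (ray i j)")
      case True
      then have "ray i j \<in> rays (T ((i div 4 + j div 4) mod m) 0)"
        using fixed[OF k a] ray(3)[OF ij] by (auto simp: in_fixed_iff)
      then show ?thesis
        using True k assms(1) by (simp add: x key_def R_def)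
    next
      case False
      then show ?thesis
        using ray(3)[OF ij] k a by (cases "i div 4 = 0") (simp_all add: x key_def R_def in_moving_iff)
    qed
  next
    fix x assume "x \<in> Sigma {..<m} (\<lambda>k. Sigma {..<m} (R k))"
    then obtain k a z where x: "x = (k, a, z)" "k < m" "a < m" "z \<in> R k a" by auto
    then have "z \<in> rays (T k a)" and inv: "invariant z \<Longrightarrow> a = 0"
      by (auto simp: R_def in_moving_iff split: if_splits)
    then obtain \<alpha> \<beta> where ab: "\<alpha> < 4" "\<beta> < 4" "z = T k a ! \<alpha> ! \<beta>"
      using in_rays_iff[OF T[OF x(2,3)]] by blast
    \<comment> \<open>The block column solving a + b = k modulo \<open>m\<close>; adding
      \<open>m\<close> first avoids truncated subtraction.\<close>
    define b where "b = (k + m - a) mod m"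
    have "b < m" using assms(1) by (simp add: b_def)
    have "(a + b) mod m = k"
      using x(2,3) by (simp add: b_def mod_add_right_eq)
    then have "key (4 * a + \<alpha>) (4 * b + \<beta>) = x"
      using ab inv by (auto simp: key_def ray_def x(1))
    moreover have "4 * a + \<alpha> < 4 * m" "4 * b + \<beta> < 4 * m"
      using ab \<open>b < m\<close> x(3) by linarith+
    ultimately show "x \<in> {key i j | i j. i < 4 * m \<and> j < 4 * m}" by blast
  qed
  also have "card \<dots> = (\<Sum>k<m. \<Sum>a<m. card (R k a))"
    by (simp add: R_def rays_def moving_def)
  also have "\<dots> = (\<Sum>k<m. card (rays (T k 0)) + (\<Sum>a<m - 1. card (moving (T k (Suc a)))))"
  proof (rule sum.cong)
    fix k
    have "(\<Sum>a<m. card (R k a)) = (\<Sum>a<Suc (m - 1). card (R k a))"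
      using assms(1) by simp
    also have "\<dots> = card (R k 0) + (\<Sum>a<m - 1. card (R k (Suc a)))"
      by (rule sum.lessThan_Suc_shift)
    finally show "(\<Sum>a<m. card (R k a)) =
        card (rays (T k 0)) + (\<Sum>a<m - 1. card (moving (T k (Suc a))))"
      by (simp add: R_def)
  qed simp
  finally show ?thesis .
qed

subsection \<open>Sums of contributions\<close>

definition sum_of :: "nat \<Rightarrow> nat set \<Rightarrow> nat \<Rightarrow> bool" where
  "sum_of N S d \<longleftrightarrow> (\<exists>s. (\<forall>i<N. s i \<in> S) \<and> (\<Sum>i<N. s i) = d)"

lemma sum_of_Suc:
  assumes "sum_of N S d" "a \<in> S"
  shows "sum_of (Suc N) S (d + a)"
proof -
  obtain s where s: "\<forall>i<N. s i \<in> S" "(\<Sum>i<N. s i) = d"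
    using assms(1) by (auto simp: sum_of_def)
  then have "(\<Sum>i<Suc N. (s(N := a)) i) = d + a" by simp
  with s(1) assms(2) show ?thesis
    unfolding sum_of_def by (intro exI[of _ "s(N := a)"]) (auto simp: less_Suc_eq)
qed

lemma sum_of_two_terms:
  assumes "a \<in> S" "b \<in> S"
  shows "sum_of 2 S (a + b)"
proof -
  have "sum_of 0 S 0" by (simp add: sum_of_def)
  from sum_of_Suc[OF sum_of_Suc[OF this assms(1)] assms(2)]
  show ?thesis by (simp add: numeral_2_eq_2)
qed

abbreviation steps :: "nat set" where
  "steps \<equiv> {0, 2, 3, 4, 5, 8, 12, 14, 15, 16}"

lemma sum_of_two:
  assumes "d \<le> 32" "d \<noteq> 1" "d \<noteq> 25"
  shows "sum_of 2 steps d"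
proof -
  \<comment> \<open>One witness pair per admissible \<open>d\<close>, ordered by sum, so that a
    single list equality checks them all. Neither 1 nor 25 is a sum of two steps.\<close>
  define pairs :: "(nat \<times> nat) list" where "pairs = [(0, 0), (0, 2), (0, 3), (0, 4), (0, 5), (2, 4), (2, 5), (0, 8), (4, 5), (2, 8), (3, 8), (0, 12), (5, 8), (0, 14), (0, 15), (0, 16), (2, 15), (2, 16), (3, 16), (4, 16), (5, 16), (8, 14), (8, 15), (8, 16), (12, 14), (12, 15), (12, 16), (14, 15), (14, 16), (15, 16), (16, 16)]"
  have "filter (\<lambda>d. d \<noteq> 1 \<and> d \<noteq> 25) [0..<33] = map (\<lambda>(a, b). a + b) pairs"
    unfolding pairs_def by code_simp
  then have "set (filter (\<lambda>d. d \<noteq> 1 \<and> d \<noteq> 25) [0..<33]) = (\<lambda>(a, b). a + b) ` set pairs"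
    by (simp only: list.set_map)
  moreover have "d \<in> set (filter (\<lambda>d. d \<noteq> 1 \<and> d \<noteq> 25) [0..<33])"
    using assms by (simp del: upt.simps upt_rec_numeral)
  ultimately have "d \<in> (\<lambda>(a, b). a + b) ` set pairs" by (simp only:)
  then obtain a b where ab: "(a, b) \<in> set pairs" "a + b = d"
    by auto
  have "set pairs \<subseteq> steps \<times> steps"
    by (simp add: pairs_def)
  then have "(a, b) \<in> steps \<times> steps"
    using ab(1) by (rule subsetD)
  then have "sum_of 2 steps (a + b)"
    by (intro sum_of_two_terms) (simp_all only: mem_Sigma_iff)
  with ab(2) show ?thesis by simp
qed

text \<open>Split off 0 if the rest still fits into \<open>N\<close> terms, and 16 otherwise. The
  gap 25 at two terms disappears at three: 25 splits off 5 and leaves 20, and 41 splits off 15 and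
  leaves 26.\<close>

lemma sum_of_steps:
  assumes "2 \<le> N" "d \<le> 16 * N" "d \<noteq> 1" "\<not> (N = 2 \<and> d = 25)"
  shows "sum_of N steps d"
  using assms
proof (induction N arbitrary: d rule: dec_induct)
  case base
  then show ?case using sum_of_two by simp
next
  case (step N)
  have "\<exists>a\<in>steps. a \<le> d \<and> d - a \<le> 16 * N \<and> d - a \<noteq> 1 \<and> \<not> (N = 2 \<and> d - a = 25)"
  proof -
    consider "N = 2" "d = 25" | "N = 2" "d = 41" | "d \<le> 16 * N" "\<not> (N = 2 \<and> d = 25)"
      | "16 * N < d" "\<not> (N = 2 \<and> d = 41)"
      by linarith
    then show ?thesis
    proof cases
      case 1 then show ?thesis by (intro bexI[of _ 5]) auto
    next
      case 2 then show ?thesis by (intro bexI[of _ 15]) auto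
    next
      case 3 then show ?thesis using step.prems by (intro bexI[of _ 0]) auto
    next
      case 4 then show ?thesis using step by (intro bexI[of _ 16]) auto
    qed
  qed
  then obtain a where a: "a \<in> steps" "a \<le> d" "d - a \<le> 16 * N" "d - a \<noteq> 1"
      "\<not> (N = 2 \<and> d - a = 25)" by blast
  show ?case
    using sum_of_Suc[OF step.IH[OF a(3-5)] a(1)] a(2) by simp
qed

text \<open>Here \<open>d\<close> is the excess over the minimum 4m. A first block with 16 lines
  instead of 4 accounts for 12, and \<open>x\<close> counts these; the other \<open>N\<close> blocks
  must supply the rest.\<close>

lemma excess_decomposition:
  assumes "2 \<le> m" "N = m * (m - 1)" "d \<le> 16 * N + 12 * m" "d \<noteq> 1" "\<not> (m = 2 \<and> d = 49)"
  obtains x where "x \<le> m" "12 * x \<le> d" "sum_of N steps (d - 12 * x)"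
proof -
  have N: "2 \<le> N"
    unfolding assms(2) using mult_le_mono[of 2 m 1 "m - 1"] assms(1) by simp
  have m2: "m = 2" if "N = 2"
  proof (rule ccontr)
    assume "m \<noteq> 2"
    with assms(1) have "3 \<le> m" "2 \<le> m - 1" by linarith+
    then have "3 * 2 \<le> m * (m - 1)" by (rule mult_le_mono)
    with that assms(2) show False by linarith
  qed
  have "\<exists>x\<le>m. 12 * x \<le> d \<and> d - 12 * x \<le> 16 * N \<and> d - 12 * x \<noteq> 1 \<and> \<not> (N = 2 \<and> d - 12 * x = 25)"
  proof (cases "N = 2 \<and> (d = 25 \<or> d = 37)")
    \<comment> \<open>Here 25 cannot be left for two terms: \<open>x = 1\<close> for 25 and
      \<open>x = 2\<close> for 37 both leave 13.\<close>
    case True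
    then show ?thesis using assms by (auto intro: exI[of _ 1] exI[of _ 2])
  next
    case False
    show ?thesis
    proof (cases "d \<le> 16 * N")
      case True
      with False assms(4) show ?thesis by (intro exI[of _ 0]) auto
    next
      case large: False
      \<comment> \<open>The fewest dense first blocks that bring the rest down to 16N; adding 11
        rounds the quotient up.\<close>
      define q where "q = (d - 16 * N + 11) div 12"
      have q: "12 * q \<le> d - 16 * N + 11" "d - 16 * N \<le> 12 * q"
        unfolding q_def by linarith+
      have qm: "q \<le> m"
        using q large assms(3) by linarith
      have "\<not> (N = 2 \<and> d - 12 * q = 25)"
      proof
        assume N2: "N = 2 \<and> d - 12 * q = 25"
        with large have "d = 25 + 12 * q" "32 < d" by auto
        moreover from this N2 have "q \<le> 2" using qm m2 by linarith
        ultimately have "q = 1 \<or> q = 2" by linarith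
        with \<open>d = 25 + 12 * q\<close> N2 m2 assms(5) False show False by auto
      qed
      moreover have "12 * q \<le> d" "d - 12 * q \<le> 16 * N" "d - 12 * q \<noteq> 1"
        using q large N by linarith+
      ultimately show ?thesis using qm by blast
    qed
  qed
  then show ?thesis using that sum_of_steps[OF N] by blast
qed

subsection \<open>Attaining all cardinalities\<close>

lemma fst_increment_tables: "fst ` set increment_tables = steps"
  by (simp add: increment_tables_def)

lemma sum_flatten:
  fixes s :: "nat \<Rightarrow> nat"
  shows "(\<Sum>k<n. \<Sum>a<p. s (k * p + a)) = (\<Sum>i<n * p. s i)"
proof -
  have "(\<Sum>a<p. s (k * p + a)) = sum s {k * p..<k * p + p}" for k
    using sum.shift_bounds_nat_ivl[of s 0 "k * p" p]
    by (simp add: atLeast0LessThan add.commute)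
  then show ?thesis
    by (simp add: sum.nat_group)
qed

text \<open>Both first blocks are dense, so the off-axis fixed lines of the third copy of
  \<open>dense_table\<close> are already present and it contributes its 10 moving lines; the fourth
  block contributes 15.\<close>

lemma attain_special:
  "\<exists>L. quantum_latin_square 8 (carrier_vec 8) L \<and> qls_cardinality 8 L = 57"
proof -
  define T where "T k a = (if k = 1 \<and> a = 1 then table15 else dense_table)" for k a :: nat
  have table15: "(15, table15) \<in> set increment_tables"
    by (simp add: increment_tables_def)
  have qls: "real_qls4 (T k a)" for k a
    using real_qls4_dense_table increment_tables(1)[OF table15] by (simp add: T_def)
  have fixed: "fixed (T k a) \<subseteq> rays (T k 0)" for k a
    using increment_tables(3)[OF table15] axis_table(1) by (auto simp: T_def in_fixed_iff)
  have "qls_cardinality (4 * 2) (block_square 2 T) =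
      (\<Sum>k<2. card (rays (T k 0)) + (\<Sum>a<2 - 1. card (moving (T k (Suc a)))))"
    using block_square_cardinality[of 2 T] qls fixed by simp
  also have "\<dots> = 57"
    using increment_tables(2)[OF table15] dense_table by (simp add: T_def numeral_2_eq_2)
  finally show ?thesis
    using block_square_qls[of 2 T] qls by auto
qed

lemma attain:
  assumes m: "0 < m" and x: "x \<le> m" and s: "sum_of (m * (m - 1)) steps e"
  shows "\<exists>L. quantum_latin_square (4 * m) (carrier_vec (4 * m)) L \<and>
    qls_cardinality (4 * m) L = 4 * m + 12 * x + e"
proof -
  obtain s where s: "\<And>i. i < m * (m - 1) \<Longrightarrow> s i \<in> fst ` set increment_tables"
      and e: "(\<Sum>i<m * (m - 1). s i) = e"
    using s unfolding sum_of_def fst_increment_tables by blast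
  have "\<forall>v\<in>fst ` set increment_tables. \<exists>t. (v, t) \<in> set increment_tables"
    by force
  then obtain tab where tab: "\<And>v. v \<in> fst ` set increment_tables \<Longrightarrow> (v, tab v) \<in> set increment_tables"
    by metis
  \<comment> \<open>The first \<open>x\<close> values of \<open>k\<close> get a dense first block.
    Blocks with \<open>a > 0\<close> are numbered consecutively, \<open>m - 1\<close> for each
    \<open>k\<close>, to match the summands \<open>s\<close>.\<close>
  define T where "T k a =
    (if a = 0 then if k < x then dense_table else axis_table else tab (s (k * (m - 1) + (a - 1))))" for k a
  have axis: "(0, axis_table) \<in> set increment_tables"
    by (simp add: increment_tables_def)
  have T: "(s (k * (m - 1) + a), T k (Suc a)) \<in> set increment_tables" if "k < m" "a < m - 1" for k a
  proof -
    have "k * (m - 1) + a < Suc k * (m - 1)"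
      using that by simp
    also have "\<dots> \<le> m * (m - 1)"
      using that by (intro mult_right_mono) auto
    finally show ?thesis
      using tab s by (simp add: T_def)
  qed
  have qls: "real_qls4 (T k a)" if "k < m" "a < m" for k a
  proof (cases a)
    case 0
    then show ?thesis
      using real_qls4_dense_table increment_tables(1)[OF axis] by (simp add: T_def)
  next
    case (Suc b)
    with that have "b < m - 1" by simp
    with that Suc increment_tables(1)[OF T[of k b]] show ?thesis by blast
  qed
  have first: "rays axis_table \<subseteq> rays (T k 0)" for k
    using axis_table(1) by (auto simp: T_def)
  have fixed: "fixed (T k a) \<subseteq> rays (T k 0)" if "k < m" "a < m" for k a
  proof (cases a)
    case 0
    then show ?thesis by (auto simp: in_fixed_iff)
  next
    case (Suc b)
    with that have "b < m - 1" by simp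
    with that Suc increment_tables(3)[OF T[of k b]] first[of k] show ?thesis by blast
  qed
  have "qls_cardinality (4 * m) (block_square m T) =
      (\<Sum>k<m. card (rays (T k 0)) + (\<Sum>a<m - 1. card (moving (T k (Suc a)))))"
    using m qls fixed by (rule block_square_cardinality)
  also have "\<dots> = (\<Sum>k<m. (4 + (if k < x then 12 else 0)) + (\<Sum>a<m - 1. s (k * (m - 1) + a)))"
  proof (intro sum.cong refl arg_cong2[where f = plus])
    fix k a assume "k \<in> {..<m}" "a \<in> {..<m - 1}"
    then show "card (moving (T k (Suc a))) = s (k * (m - 1) + a)"
      using increment_tables(2)[OF T[of k a]] by simp
  qed (simp add: T_def axis_table dense_table)
  also have "\<dots> = 4 * m + (\<Sum>k<m. if k < x then 12 else 0) + e"
    using e by (simp add: sum.distrib sum_flatten)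
  also have "(\<Sum>k<m. if k < x then 12 else 0 :: nat) = 12 * x"
  proof -
    have "{..<m} \<inter> {k. k < x} = {..<x}"
      using x by auto
    then show ?thesis by (simp add: sum.If_cases)
  qed
  finally have "qls_cardinality (4 * m) (block_square m T) = 4 * m + 12 * x + e"
    by simp
  moreover have "quantum_latin_square (4 * m) (carrier_vec (4 * m)) (block_square m T)"
    using m qls by (rule block_square_qls)
  ultimately show ?thesis by blast
qed

theorem theorem1p1:
  fixes m c :: nat
  assumes "m \<ge> 2"
    and "4 * m \<le> c" and "c \<le> 16 * m ^ 2" and "c \<noteq> 4 * m + 1"
  shows "\<exists>L. quantum_latin_square (4 * m)
               (tensor_space (m * 2) 2
                 (tensor_space m 2 (carrier_vec m) (carrier_vec 2)) (carrier_vec 2)) L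
           \<and> qls_cardinality (4 * m) L = c"
proof -
  have "m * 2 * 2 = 4 * m" by simp
  then have H: "tensor_space (m * 2) 2 (tensor_space m 2 (carrier_vec m) (carrier_vec 2)) (carrier_vec 2)
      = carrier_vec (4 * m)"
    by (simp only: tensor_space_carrier)
  show ?thesis
  proof (cases "m = 2 \<and> c = 57")
    case True
    with attain_special show ?thesis unfolding H by simp
  next
    case False
    \<comment> \<open>This rewrites the largest excess 16m^2 - 4m as 16m(m-1) + 12m, the form
      required for the decomposition. The excluded excess 49 at \<open>m = 2\<close> is the value 57
      treated above.\<close>
    have "m * m = m * (m - 1) + m"
      using assms(1) by (cases m) auto
    then have "c - 4 * m \<le> 16 * (m * (m - 1)) + 12 * m"
      using assms(3) by (simp add: power2_eq_square)
    moreover have "c - 4 * m \<noteq> 1" "\<not> (m = 2 \<and> c - 4 * m = 49)"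
      using assms(2,4) False by auto
    ultimately obtain x where x: "x \<le> m" "12 * x \<le> c - 4 * m"
        "sum_of (m * (m - 1)) steps (c - 4 * m - 12 * x)"
      by (rule excess_decomposition[OF assms(1) refl])
    have "4 * m + 12 * x + (c - 4 * m - 12 * x) = c"
      using assms(2) x(2) by simp
    with attain[OF _ x(1,3)] assms(1) show ?thesis
      unfolding H by simp
  qed
qed

end
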